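(* Suppose the move costs do not depend on the disc, i.e. $w_{n,k}=w_k$ for all $n\in\mathbb{N}_0$ and $k\in T=\{0,1,2\}$, and put $w=(w_0,w_1,w_2)^{\mathrm t}$, $|w|=w_0+w_1+w_2$. Suppose that at each level the one-largest-disc-move strategy is optimal, i.e. $d_{n+1,k}=d_{n,i}+d_{n,j}+w_k$ for all $n\in\mathbb{N}_0$ and all $\{i,j,k\}=T$; equivalently, the vectors $d_n=(d_{n,0},d_{n,1},d_{n,2})^{\mathrm t}$ satisfy $$d_0=(0,0,0)^{\mathrm t},\qquad d_{n+1}=\mathbf{A}d_n+w,\qquad \mathbf{A}=\begin{pmatrix}0&1&1\\1&0&1\\1&1&0\end{pmatrix}.$$ Then, for all $n\in\mathbb{N}_0$, $$d_n=|w|\,\ell_{n-1}\,(1,1,1)^{\mathrm t}+c_n\,w,$$ where $\ell_n=\sum_{\nu=0}^{n}J_\nu$ for $n\ge-1$ (so $\ell_{-1}=0$) is the Lichtenberg sequence and $c_n=n\bmod 2$.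
   Context: $J_n=\frac13(2^n-(-1)^n)$, $n\in\mathbb{N}_0$, are the Jacobsthal numbers. Weighted Tower of Hanoi: $\mathbb{N}_0$ denotes the nonnegative integers; $T=\{0,1,2\}$ is the set of pegs; discs are labelled $1,2,3,\dots$ by increasing size. A state with $n$ discs is an assignment of the discs $1,\dots,n$ to the pegs, the discs on each peg being stacked with smaller discs above larger ones. A legal move transfers the topmost (smallest) disc of one peg to a different peg carrying no smaller disc. For $i\in T$, $i^n$ is the perfect state with all $n$ discs on peg $i$. For $\{i,j,k\}=T$ and $n\in\mathbb{N}_0$, $w_{n,k}\in[0,\infty)$ is a given cost of a single move of disc $n+1$ between pegs $i$ and $j$ (in either direction), and $d_{n,k}$ is the minimal total cost, over all finite sequences of legal moves, of getting from $i^n$ to $j^n$ with $n$ discs. *)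

theory Defs
  imports "HOL-Analysis.Analysis"
begin

text \<open>
  The set of pegs \<open>T = {0, 1, 2}\<close> is the three-element type \<open>3\<close>, so that \<open>{i, j, k} = T\<close> reads
  \<open>{i, j, k} = UNIV\<close>, and vectors indexed by \<open>T\<close> have type \<open>real ^ 3\<close>.
  The arithmetic of type \<open>3\<close> is modulo 3.
\<close>

type_synonym peg = 3

type_synonym state = "nat \<Rightarrow> peg"

text \<open>
  A state with \<open>n\<close> discs is determined by the peg of each disc \<open>1, \<dots>, n\<close>, since the discs on a peg
  are stacked by size. States are extensional, so they are equal iff they agree on \<open>{1..n}\<close>.
\<close>

definition states :: "nat \<Rightarrow> state set" where
  "states n = {1..n} \<rightarrow>\<^sub>E UNIV"

definition perfect :: "nat \<Rightarrow> peg \<Rightarrow> state" where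
  "perfect n i = (\<lambda>m\<in>{1..n}. i)"

definition legal_move :: "nat \<Rightarrow> state \<Rightarrow> nat \<Rightarrow> peg \<Rightarrow> bool" where
  "legal_move n s m j \<longleftrightarrow>
     m \<in> {1..n} \<and> j \<noteq> s m \<and> (\<forall>m'\<in>{1..<m}. s m' \<noteq> s m \<and> s m' \<noteq> j)"

text \<open>
  \<open>move_seq w n s t c\<close>: some finite sequence of legal moves leads from \<open>s\<close> to \<open>t\<close> at total cost \<open>c\<close>.
  The cost of moving disc \<open>m + 1\<close> between pegs \<open>i\<close> and \<open>j\<close> is \<open>w m $ k\<close>, where \<open>k\<close> is the third peg.
\<close>

inductive move_seq :: "(nat \<Rightarrow> real ^ 3) \<Rightarrow> nat \<Rightarrow> state \<Rightarrow> state \<Rightarrow> real \<Rightarrow> bool"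
  for w :: "nat \<Rightarrow> real ^ 3" and n :: nat where
  empty: "s \<in> states n \<Longrightarrow> move_seq w n s s 0"
| move: "move_seq w n s t c \<Longrightarrow> legal_move n t m j \<Longrightarrow> {t m, j, k} = UNIV
    \<Longrightarrow> move_seq w n s (t(m := j)) (c + w (m - 1) $ k)"

definition min_cost :: "(nat \<Rightarrow> real ^ 3) \<Rightarrow> nat \<Rightarrow> state \<Rightarrow> state \<Rightarrow> real" where
  "min_cost w n s t = Inf {c. move_seq w n s t c}"

text \<open>
  The two pegs other than \<open>k\<close> are \<open>k + 1\<close> and \<open>k + 2\<close>; by lemma \<open>hanoi_cost_eq\<close> below, their
  order does not matter.
\<close>

definition hanoi_cost :: "(nat \<Rightarrow> real ^ 3) \<Rightarrow> nat \<Rightarrow> real ^ 3" where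
  "hanoi_cost w n = (\<chi> k. min_cost w n (perfect n (k + 1)) (perfect n (k + 2)))"

definition one_largest_move_optimal :: "(nat \<Rightarrow> real ^ 3) \<Rightarrow> bool" where
  "one_largest_move_optimal w \<longleftrightarrow>
     (\<forall>n i j k. {i, j, k} = UNIV \<longrightarrow>
        hanoi_cost w (Suc n) $ k = hanoi_cost w n $ i + hanoi_cost w n $ j + w n $ k)"

definition matA :: "real ^ 3 ^ 3" where
  "matA = (\<chi> i j. if i = j then 0 else 1)"

definition jacobsthal :: "nat \<Rightarrow> real" where
  "jacobsthal n = (2 ^ n - (- 1) ^ n) / 3"

text \<open>The index is an integer because the sequence starts at \<open>-1\<close>, where the sum is empty.\<close>

definition lichtenberg :: "int \<Rightarrow> real" where
  "lichtenberg n = (\<Sum>\<nu>=0..n. jacobsthal (nat \<nu>))"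

lemma move_seq_states:
  assumes "move_seq w n s t c"
  shows "s \<in> states n \<and> t \<in> states n"
  using assms
  by induction (auto simp: states_def legal_move_def PiE_iff extensional_def)

lemma move_seq_Cons:
  assumes "move_seq w n (s(m := j)) t c" "s \<in> states n" "legal_move n s m j" "{s m, j, k} = UNIV"
  shows "move_seq w n s t (w (m - 1) $ k + c)"
  using assms
proof (induction "s(m := j)" t c)
  case empty
  then show ?case
    using move_seq.move[OF move_seq.empty] by fastforce
next
  case (move t c m' j' k')
  then show ?case
    using move_seq.move by (metis add.assoc)
qed

lemma move_seq_sym:
  assumes "move_seq w n s t c"
  shows "move_seq w n t s c"
  using assms
proof induction
  case (empty s)
  then show ?case by (rule move_seq.empty)
next
  case (move s t c m j k)
  have t: "t \<in> states n"
    using move_seq_states[OF move.hyps(1)] by simp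
  have st: "t(m := j) \<in> states n"
    using t move.hyps(2) by (auto simp: states_def legal_move_def PiE_iff extensional_def)
  have "legal_move n (t(m := j)) m (t m)"
    using move.hyps(2) by (auto simp: legal_move_def)
  moreover have "{(t(m := j)) m, t m, k} = UNIV"
    using move.hyps(3) by (simp add: insert_commute)
  moreover have "move_seq w n ((t(m := j))(m := t m)) s c"
    using move.IH by simp
  ultimately have "move_seq w n (t(m := j)) s (w (m - 1) $ k + c)"
    using st by (intro move_seq_Cons)
  then show ?case
    by (simp only: add.commute)
qed

lemma hanoi_cost_eq:
  assumes "{i, j, k} = UNIV"
  shows "hanoi_cost w n $ k = min_cost w n (perfect n i) (perfect n j)"
proof -
  have sym: "min_cost w n s t = min_cost w n t s" for s t
    unfolding min_cost_def by (rule arg_cong[where f = Inf], auto simp: move_seq_sym)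
  have "\<forall>i j k :: 3. {i, j, k} = UNIV \<longrightarrow> i = k + 1 \<and> j = k + 2 \<or> i = k + 2 \<and> j = k + 1"
    unfolding forall_3 by (simp add: set_eq_iff forall_3)
  then have "i = k + 1 \<and> j = k + 2 \<or> i = k + 2 \<and> j = k + 1"
    using assms by blast
  then show ?thesis
    using sym[of "perfect n i" "perfect n j"] by (auto simp: hanoi_cost_def)
qed

end

theory Submission imports Defs begin

text \<open>
  With no discs there is no legal move, so \<open>d\<^sub>0 = 0\<close>, and the equivalence only rewrites the scalar
  recurrence as a matrix recurrence: row \<open>k\<close> of \<open>A x\<close> is the sum of the entries of \<open>x\<close> at the two
  other indices (\<open>matA_component\<close>).

  The closed form comes from the invariance under \<open>A\<close> of the span of \<open>w\<close> and
  \<open>u = (1,1,1)\<close>: since \<open>A x = |x| u - x\<close>, one has \<open>A u = 2 u\<close> and \<open>A w = |w| u - w\<close>.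
  If \<open>d\<^sub>n = |w| a u + c w\<close>, then
  \<open>d\<^sub>n\<^sub>+\<^sub>1 = |w| (2 a + c) u + (1 - c) w\<close>. The coefficient of \<open>w\<close> therefore alternates
  between \<open>0\<close> and \<open>1\<close>, and that of \<open>|w| u\<close> obeys \<open>a\<^sub>n\<^sub>+\<^sub>1 = 2 a\<^sub>n + (n mod 2)\<close>. This is
  the recurrence of the shifted Lichtenberg sequence (\<open>lichtenberg_double\<close>), because the sum of
  the Jacobsthal numbers below an index differs from the one at it only by the parity of the index
  (\<open>lichtenberg_eq_jacobsthal\<close>).
\<close>

lemma peg_numerals: "(3 :: peg) = 0" "(4 :: peg) = 1" "(5 :: peg) = 2"
  by simp_all

lemma UNIV_peg_iff:
  fixes i j k :: peg
  shows "{i, j, k} = UNIV \<longleftrightarrow> i = k + 1 \<and> j = k + 2 \<or> i = k + 2 \<and> j = k + 1"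
proof -
  have "\<forall>i j k :: 3. {i, j, k} = UNIV \<longleftrightarrow> i = k + 1 \<and> j = k + 2 \<or> i = k + 2 \<and> j = k + 1"
    unfolding forall_3 by (simp add: set_eq_iff forall_3)
  then show ?thesis by blast
qed

lemma move_seq_0_cost:
  assumes "move_seq w 0 s t c"
  shows "c = 0"
  using assms by induction (auto simp: legal_move_def)

text \<open>All perfect states without discs coincide, so the infimum is over the one cost \<open>0\<close>.\<close>

lemma hanoi_cost_0: "hanoi_cost w 0 = 0"
proof -
  have "{c. move_seq w 0 (perfect 0 i) (perfect 0 j) c} = {0}" for i j
  proof -
    have "move_seq w 0 (perfect 0 i) (perfect 0 j) 0"
      using move_seq.empty[of "perfect 0 i" 0 w]
      by (simp add: perfect_def states_def restrict_def)
    then show ?thesis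
      using move_seq_0_cost by blast
  qed
  then show ?thesis
    by (simp add: hanoi_cost_def min_cost_def vec_eq_iff)
qed

lemma matA_component: "(matA *v x) $ k = x $ (k + 1) + x $ (k + 2)"
proof -
  have "\<forall>k. (matA *v x) $ k = x $ (k + 1) + x $ (k + 2)"
    unfolding forall_3 by (simp add: matA_def matrix_vector_mult_def sum_3 peg_numerals)
  then show ?thesis by blast
qed

lemma matA_eq_total_minus:
  "matA *v x = (x $ 0 + x $ 1 + x $ 2) *\<^sub>R (\<chi> k. 1) - x"
proof -
  have "\<forall>k. (matA *v x) $ k = x $ 0 + x $ 1 + x $ 2 - x $ k"
    unfolding forall_3 by (simp add: matA_component peg_numerals)
  then show ?thesis by (simp add: vec_eq_iff)
qed

lemma one_largest_move_optimal_iff_matA: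
  "one_largest_move_optimal w \<longleftrightarrow>
     (\<forall>n. hanoi_cost w (Suc n) = matA *v hanoi_cost w n + w n)"
  unfolding one_largest_move_optimal_def UNIV_peg_iff
  by (auto simp: vec_eq_iff matA_component)

lemma lichtenberg_step: "lichtenberg (int n) = lichtenberg (int n - 1) + jacobsthal n"
proof -
  have "{0..int n} = insert (int n) {0..int n - 1}" by auto
  then show ?thesis by (simp add: lichtenberg_def)
qed

text \<open>
  The Jacobsthal recurrence \<open>J\<^sub>n\<^sub>+\<^sub>1 = 2 J\<^sub>n + (-1)\<^sup>n\<close> telescopes: \<open>J\<^sub>n\<close> is the increment of
  \<open>J\<^sub>n - (n mod 2)\<close>, since the parity changes by \<open>(-1)\<^sup>n\<close>.
\<close>

lemma lichtenberg_eq_jacobsthal: "lichtenberg (int n - 1) = jacobsthal n - real (n mod 2)"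
proof (induction n)
  case 0
  then show ?case by (simp add: lichtenberg_def jacobsthal_def)
next
  case (Suc n)
  have "jacobsthal (Suc n) - real (Suc n mod 2) = 2 * jacobsthal n - real (n mod 2)"
    by (cases "even n") (auto simp: jacobsthal_def mod_2_eq_odd field_simps)
  then show ?case
    using Suc lichtenberg_step[of n] by simp
qed

lemma lichtenberg_double: "lichtenberg (int n) = 2 * lichtenberg (int n - 1) + real (n mod 2)"
  using lichtenberg_step[of n] lichtenberg_eq_jacobsthal[of n] by simp

lemma matA_recurrence_solution:
  assumes "d 0 = 0" and "\<And>n. d (Suc n) = matA *v d n + w"
  shows "d n = ((w $ 0 + w $ 1 + w $ 2) * lichtenberg (int n - 1)) *\<^sub>R (\<chi> k. 1)
               + real (n mod 2) *\<^sub>R w"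
proof (induction n)
  case 0
  then show ?case using assms(1) by (simp add: lichtenberg_def)
next
  case (Suc n)
  have parity: "real (Suc n mod 2) = 1 - real (n mod 2)"
    by (simp add: mod_2_eq_odd)
  show ?case
    unfolding assms(2) Suc.IH matA_eq_total_minus parity
    by (simp add: vec_eq_iff lichtenberg_double algebra_simps)
qed

theorem theorem2:
  fixes W :: "nat \<Rightarrow> real ^ 3" and w :: "real ^ 3"
  assumes nonneg: "\<And>n k. 0 \<le> W n $ k"
    and disc_independent: "\<And>n k. W n $ k = w $ k"
  shows "(one_largest_move_optimal W \<longleftrightarrow>
            hanoi_cost W 0 = 0 \<and>
            (\<forall>n. hanoi_cost W (Suc n) = matA *v hanoi_cost W n + w)) \<and>
         (one_largest_move_optimal W \<longrightarrow>
            (\<forall>n. hanoi_cost W n =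
               ((w $ 0 + w $ 1 + w $ 2) * lichtenberg (int n - 1)) *\<^sub>R (\<chi> k. 1)
               + real (n mod 2) *\<^sub>R w))"
proof -
  have "W n = w" for n
    by (simp add: vec_eq_iff disc_independent)
  then have recurrence: "one_largest_move_optimal W \<longleftrightarrow>
      (\<forall>n. hanoi_cost W (Suc n) = matA *v hanoi_cost W n + w)"
    by (simp add: one_largest_move_optimal_iff_matA)
  show ?thesis
    using recurrence hanoi_cost_0 matA_recurrence_solution[of "hanoi_cost W" w] by blast
qed

end
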